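(* Let $c_1>c_2>1$, $0<\alpha<1$, $\Delta>0$ be reals. Let $G=(V,E)$ be a graph on $n$ vertices satisfying: (1) $\frac{|E|}{|V|}\ge c_1$; (2) every nonempty vertex subset $W\subset V$ of size $|W|\le \alpha n$ spans less than $c_2|W|$ edges of $G$; (3) the maximum degree of $G$ is at most $\Delta$. Then $G$ contains an induced subgraph $G^*=(V^*,E^* )$ on at least $\alpha n$ vertices which is a $\gamma$-expander, for $\gamma=\frac{c_1-c_2}{\Delta\cdot\left\lceil\log_2\frac{1}{\alpha}\right\rceil}$.
   Context: Graphs are finite and simple. A set $W\subset V$ spans an edge if both endpoints of the edge lie in $W$. For a graph $G=(V,E)$ and $W\subset V$, the external neighborhood is $N_G(W)=\{v\in V\setminus W: v \text{ has a neighbor in } W\}$. For $\gamma>0$, a graph $G=(V,E)$ on $m$ vertices is a $\gamma$-expander if $|N_G(W)|\ge \gamma|W|$ for every $W\subset V$ with $|W|\le m/2$. *)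

theory Defs
  imports Complex_Main
begin

definition simple_graph :: "'a set \<Rightarrow> 'a set set \<Rightarrow> bool" where
  "simple_graph V E \<longleftrightarrow> finite V \<and> (\<forall>e\<in>E. e \<subseteq> V \<and> card e = 2)"

definition spanned_edges :: "'a set set \<Rightarrow> 'a set \<Rightarrow> 'a set set" where
  "spanned_edges E W = {e \<in> E. e \<subseteq> W}"

definition induced_subgraph :: "'a set \<Rightarrow> 'a set set \<Rightarrow> 'a set \<Rightarrow> 'a set set \<Rightarrow> bool" where
  "induced_subgraph V' E' V E \<longleftrightarrow> V' \<subseteq> V \<and> E' = spanned_edges E V'"

definition degree :: "'a set set \<Rightarrow> 'a \<Rightarrow> nat" where
  "degree E v = card {e \<in> E. v \<in> e}"

text \<open>Unspecified for the graph without vertices, where the maximum is over the empty set.\<close>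

definition max_degree :: "'a set \<Rightarrow> 'a set set \<Rightarrow> nat" where
  "max_degree V E = Max (degree E ` V)"

definition ext_neighborhood :: "'a set \<Rightarrow> 'a set set \<Rightarrow> 'a set \<Rightarrow> 'a set" where
  "ext_neighborhood V E W = {v \<in> V - W. \<exists>w\<in>W. {v, w} \<in> E}"

definition expander :: "real \<Rightarrow> 'a set \<Rightarrow> 'a set set \<Rightarrow> bool" where
  "expander \<gamma> V E \<longleftrightarrow> \<gamma> > 0 \<and>
     (\<forall>W\<subseteq>V. real (card W) \<le> real (card V) / 2 \<longrightarrow>
        real (card (ext_neighborhood V E W)) \<ge> \<gamma> * real (card W))"

end

theory Submission
  imports Defs
begin

text \<open>Put \<open>\<delta> = (c1 - c2) / k\<close> with \<open>k = \<lceil>log 2 (1 / \<alpha>)\<rceil>\<close>, and take a minimal nonempty \<open>U\<close> such that, for some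
  \<open>j \<le> k\<close>, \<open>U\<close> has at most \<open>n / 2 ^ j\<close> vertices and edge density at least \<open>c1 - j * \<delta>\<close>. This density is at
  least \<open>c2\<close>, so \<open>U\<close> has more than \<open>\<alpha> * n\<close> vertices, which forces \<open>j < k\<close>. A set \<open>W\<close> violating expansion
  in \<open>U\<close> is joined to \<open>U - W\<close> by fewer than \<open>\<delta> * |W|\<close> edges, so either \<open>U - W\<close> keeps the density, or
  \<open>W\<close> loses at most \<open>\<delta>\<close> while having at most half the vertices; both contradict minimality.\<close>

lemma finite_edges:
  assumes "simple_graph V E"
  shows "finite E"
proof -
  have "E \<subseteq> Pow V" "finite V"
    using assms by (auto simp: simple_graph_def)
  then show ?thesis
    by (meson finite_Pow_iff finite_subset)
qed

lemma simple_graph_edgeE: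
  assumes "simple_graph V E" "e \<in> E"
  obtains x y where "e = {x, y}" "x \<noteq> y" "x \<in> V" "y \<in> V"
proof -
  have "card e = 2" "e \<subseteq> V"
    using assms by (auto simp: simple_graph_def)
  then show thesis
    using that by (auto simp: card_2_iff)
qed

lemma degree_le_max_degree:
  assumes "finite V" "v \<in> V"
  shows "degree E v \<le> max_degree V E"
  using assms by (simp add: max_degree_def)

text \<open>An edge inside \<open>U\<close> that lies neither in \<open>W\<close> nor in
  \<open>U - W\<close> crosses between them. Its endpoint outside \<open>W\<close> is then an
  external neighbor of \<open>W\<close>, and each such vertex accounts for at most
  \<open>max_degree V E\<close> edges.\<close>

lemma card_spanned_edges_split:
  assumes G: "simple_graph V E" and UV: "U \<subseteq> V"
  shows "card (spanned_edges E U) \<le> card (spanned_edges E W) + card (spanned_edges E (U - W))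
    + max_degree V E * card (ext_neighborhood U (spanned_edges E U) W)"
proof -
  define N where "N = ext_neighborhood U (spanned_edges E U) W"
  define F where "F = (\<Union>v\<in>N. {e \<in> E. v \<in> e})"
  have finE: "finite E" and finV: "finite V"
    using G finite_edges by (auto simp: simple_graph_def)
  have NV: "N \<subseteq> V"
    using UV by (auto simp: N_def ext_neighborhood_def)
  then have finN: "finite N"
    using finV finite_subset by blast
  have "spanned_edges E U \<subseteq> spanned_edges E W \<union> spanned_edges E (U - W) \<union> F"
  proof
    fix e assume e: "e \<in> spanned_edges E U"
    then have eE: "e \<in> E"
      by (simp add: spanned_edges_def)
    with G obtain x y where xy: "e = {x, y}"
      by (rule simple_graph_edgeE)
    have N: "v \<in> N" if "e = {v, w}" "v \<notin> W" "w \<in> W" for v w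
      using e that by (auto simp: N_def ext_neighborhood_def spanned_edges_def)
    have "e = {y, x}"
      using xy by blast
    then have "e \<subseteq> W \<or> e \<subseteq> U - W \<or> x \<in> N \<or> y \<in> N"
      using N[OF xy] N[of y x] e xy by (auto simp: spanned_edges_def)
    then show "e \<in> spanned_edges E W \<union> spanned_edges E (U - W) \<union> F"
      using eE xy by (auto simp: F_def spanned_edges_def)
  qed
  moreover have "finite (spanned_edges E W \<union> spanned_edges E (U - W) \<union> F)"
    using finE finN by (simp add: spanned_edges_def F_def)
  ultimately have "card (spanned_edges E U) \<le> card (spanned_edges E W \<union> spanned_edges E (U - W) \<union> F)"
    by (intro card_mono)
  also have "\<dots> \<le> card (spanned_edges E W) + card (spanned_edges E (U - W)) + card F"
    using card_Un_le[of "spanned_edges E W \<union> spanned_edges E (U - W)" F]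
      card_Un_le[of "spanned_edges E W" "spanned_edges E (U - W)"] by linarith
  also have "card F \<le> (\<Sum>v\<in>N. degree E v)"
    using card_UN_le[OF finN] by (simp add: F_def degree_def)
  also have "\<dots> \<le> max_degree V E * card N"
    using sum_bounded_above[of N "degree E" "max_degree V E"] degree_le_max_degree[OF finV] NV
    by (auto simp: mult.commute)
  finally show ?thesis
    by (simp add: N_def)
qed

theorem theorem1:
  fixes V :: "'a set" and E :: "'a set set" and n :: nat
    and c1 c2 \<alpha> \<Delta> :: real
  assumes "c1 > c2" and "c2 > 1"
    and "0 < \<alpha>" and "\<alpha> < 1"
    and "\<Delta> > 0"
    and "simple_graph V E" and "card V = n"
    and "real (card E) / real (card V) \<ge> c1"
    and "\<And>W. W \<subseteq> V \<Longrightarrow> W \<noteq> {} \<Longrightarrow> real (card W) \<le> \<alpha> * real n \<Longrightarrow>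
           real (card (spanned_edges E W)) < c2 * real (card W)"
    and "real (max_degree V E) \<le> \<Delta>"
  shows "\<exists>V' E'. induced_subgraph V' E' V E \<and> real (card V') \<ge> \<alpha> * real n \<and>
           expander ((c1 - c2) / (\<Delta> * of_int \<lceil>log 2 (1 / \<alpha>)\<rceil>)) V' E'"
proof -
  define k where "k = nat \<lceil>log 2 (1 / \<alpha>)\<rceil>"
  define \<delta> where "\<delta> = (c1 - c2) / real k"
  define \<gamma> where "\<gamma> = (c1 - c2) / (\<Delta> * of_int \<lceil>log 2 (1 / \<alpha>)\<rceil>)"
  \<comment> \<open>Since \<alpha> < 1, the ceiling is at least 1: \<open>nat\<close> loses nothing
    and dividing by \<open>k\<close> is harmless.\<close>
  have "log 2 (1 / \<alpha>) > 0"
    using assms(3,4) by simp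
  then have k: "of_int \<lceil>log 2 (1 / \<alpha>)\<rceil> = real k" "k > 0"
    by (simp_all add: k_def)
  have \<delta>: "\<delta> > 0" "c1 - real k * \<delta> = c2"
    using assms(1) k by (simp_all add: \<delta>_def)
  have \<gamma>: "\<gamma> > 0" "\<Delta> * \<gamma> = \<delta>"
    using assms(1,5) k by (simp_all add: \<gamma>_def \<delta>_def)
  \<comment> \<open>Rounding up ensures that \<open>k\<close> halvings bring \<open>n\<close> down
    to at most \<alpha> * \<open>n\<close>.\<close>
  have "log 2 (1 / \<alpha>) \<le> real k"
    using k(1) by linarith
  then have "1 / \<alpha> \<le> 2 ^ k"
    using assms(3) by (simp add: log_le_iff powr_realpow)
  then have half_k: "1 / 2 ^ k \<le> \<alpha>"
    using assms(3) by (simp add: field_simps)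
  have finV: "finite V"
    using assms(6) by (simp add: simple_graph_def)
  \<comment> \<open>For empty \<open>V\<close> the quotient in the density hypothesis is 0 by the
    convention for division by zero, yet \<open>c1\<close> > 1.\<close>
  have "V \<noteq> {}"
    using assms(1,2,8) by auto
  define dense where "dense = (\<lambda>U j. U \<subseteq> V \<and> U \<noteq> {} \<and> j \<le> k \<and> real (card U) \<le> real n / 2 ^ j
    \<and> real (card (spanned_edges E U)) \<ge> (c1 - real j * \<delta>) * real (card U))"
  have "spanned_edges E V = E"
    using assms(6) by (auto simp: simple_graph_def spanned_edges_def)
  moreover have "real (card E) \<ge> c1 * real (card V)"
    using assms(8) \<open>V \<noteq> {}\<close> finV by (simp add: field_simps card_gt_0_iff)
  ultimately have "dense V 0"
    using \<open>V \<noteq> {}\<close> assms(7) by (simp add: dense_def)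
  then have "\<exists>j. dense V j" ..
  \<comment> \<open>The minimum is taken over all levels at once, so that a competitor at level
    \<open>j\<close> or at level \<open>Suc j\<close> contradicts it.\<close>
  from ex_has_least_nat[of "\<lambda>U. \<exists>j. dense U j", OF this, of card]
  obtain U where "\<exists>j. dense U j" and least: "\<And>U' j. dense U' j \<Longrightarrow> card U \<le> card U'"
    by auto
  then obtain j where U: "U \<subseteq> V" "U \<noteq> {}" "j \<le> k" "real (card U) \<le> real n / 2 ^ j"
    "real (card (spanned_edges E U)) \<ge> (c1 - real j * \<delta>) * real (card U)"
    by (auto simp: dense_def)
  have finU: "finite U"
    using U(1) finV finite_subset by blast
  have "c2 \<le> c1 - real j * \<delta>"
    using \<delta> U(3) mult_right_mono[of "real j" "real k" \<delta>] by linarith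
  then have "c2 * real (card U) \<le> real (card (spanned_edges E U))"
    using U(5) mult_right_mono[of c2 "c1 - real j * \<delta>" "real (card U)"] by simp
  then have large: "real (card U) > \<alpha> * real n"
    using assms(9)[OF U(1,2)] by linarith
  have "j \<noteq> k"
    using large U(4) mult_right_mono[OF half_k, of "real n"] by auto
  with U(3) have "Suc j \<le> k"
    by simp
  have "\<gamma> * real (card W) \<le> real (card (ext_neighborhood U (spanned_edges E U) W))"
    if W: "W \<subseteq> U" "real (card W) \<le> real (card U) / 2" for W
  proof (rule ccontr)
    define N where "N = ext_neighborhood U (spanned_edges E U) W"
    assume "\<not> ?thesis"
    then have small: "real (card N) < \<gamma> * real (card W)"
      by (simp add: N_def)
    \<comment> \<open>For empty \<open>W\<close> the strict inequality would read
      \<open>card N\<close> < 0.\<close>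
    then have "W \<noteq> {}"
      by auto
    have finW: "finite W"
      using W(1) finU finite_subset by blast
    have cardW: "0 < card W"
      using finW \<open>W \<noteq> {}\<close> by (simp add: card_gt_0_iff)
    have cardUW: "card (U - W) = card U - card W" and WU: "card W < card U"
      using card_Diff_subset[OF finW W(1)] W(2) cardW by auto
    \<comment> \<open>The factor \<Delta> in the denominator of \<gamma> is absorbed here: few
      neighbors become few crossing edges.\<close>
    have "real (max_degree V E) * real (card N) \<le> \<Delta> * real (card N)"
      using assms(10) by (intro mult_right_mono) auto
    also have "\<dots> \<le> \<delta> * real (card W)"
      using small assms(5) \<gamma>(2) by (metis less_imp_le mult.assoc mult_left_mono)
    finally have cross: "real (max_degree V E) * real (card N) \<le> \<delta> * real (card W)" .
    have "real (card (spanned_edges E U)) \<le> real (card (spanned_edges E W))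
        + real (card (spanned_edges E (U - W))) + real (max_degree V E) * real (card N)"
      using card_spanned_edges_split[OF assms(6) U(1), of W]
      by (simp add: N_def flip: of_nat_add of_nat_mult)
    with cross U(5) have split: "(c1 - real j * \<delta>) * real (card U) \<le> real (card (spanned_edges E W))
        + real (card (spanned_edges E (U - W))) + \<delta> * real (card W)"
      by linarith
    have "real (card U) = real (card W) + real (card (U - W))"
      using cardUW WU by simp
    then have "(c1 - real j * \<delta>) * real (card U)
        = (c1 - real j * \<delta>) * real (card W) + (c1 - real j * \<delta>) * real (card (U - W))"
      by (simp only: distrib_left)
    moreover have "(c1 - real (Suc j) * \<delta>) * real (card W)
        = (c1 - real j * \<delta>) * real (card W) - \<delta> * real (card W)"
      by (simp add: algebra_simps)
    \<comment> \<open>If both alternatives failed, adding the two strict inequalities would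
      contradict \<open>split\<close>: the loss \<delta> * \<open>card W\<close> is charged to
      \<open>W\<close> alone.\<close>
    ultimately consider
        "(c1 - real j * \<delta>) * real (card (U - W)) \<le> real (card (spanned_edges E (U - W)))"
      | "(c1 - real (Suc j) * \<delta>) * real (card W) \<le> real (card (spanned_edges E W))"
      using split by linarith
    then show False
    proof cases
      case 1
      \<comment> \<open>The size bound at level \<open>j\<close> passes to subsets, and
        \<open>U - W\<close> is nonempty because \<open>card W\<close> <
        \<open>card U\<close>.\<close>
      then have "dense (U - W) j"
        using U WU cardUW W(1) by (auto simp: dense_def)
      then show False
        using least cardUW WU cardW by fastforce
    next
      case 2
      moreover have "real (card W) \<le> real n / 2 ^ Suc j"
        using W(2) U(4) by simp
      ultimately have "dense W (Suc j)"
        using U(1) W(1) \<open>W \<noteq> {}\<close> \<open>Suc j \<le> k\<close> by (auto simp: dense_def)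
      then show False
        using least WU by fastforce
    qed
  qed
  then have "expander \<gamma> U (spanned_edges E U)"
    using \<gamma>(1) by (simp add: expander_def)
  then show ?thesis
    using U(1) large by (auto simp: induced_subgraph_def \<gamma>_def intro: less_imp_le)
qed

end
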